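(* Let $\mu$ be a nontrivial probability measure on $\partial\mathbb D$ with Verblunsky coefficients $(\alpha_n)$, and suppose $\lim_{n\to\infty}|\alpha_n|^{1/n}=r$ and $\frac1n\sum_{j=0}^{n-1}|\alpha_j|\to0$. Then the zero counting measures $\nu_n$ of $\Phi_n$ converge weakly to the uniform probability measure on the circle $\{|z|=r\}$.
   Context: $\partial\mathbb D$ is the unit circle; nontrivial means infinite support. $\Phi_n$ is the monic polynomial of degree $n$ with $\int\overline{z^j}\Phi_n\,d\mu=0$ for $0\le j<n$; $\alpha_n=-\overline{\Phi_{n+1}(0)}$. $\nu_n$ is the probability measure on $\overline{\mathbb D}$ giving weight $k/n$ to each zero of $\Phi_n$ of multiplicity $k$. *)

theory Defs
  imports "HOL-Probability.Probability" "HOL-Computational_Algebra.Polynomial"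
begin

definition msupport :: "complex measure \<Rightarrow> complex set" where
  "msupport mu = {z. \<forall>e>0. emeasure mu (ball z e) > 0}"

definition OPUC :: "complex measure \<Rightarrow> nat \<Rightarrow> complex poly" where
  "OPUC mu n = (THE p. degree p = n \<and> lead_coeff p = 1 \<and>
      (\<forall>j<n. (\<integral>z. cnj (z ^ j) * poly p z \<partial>mu) = 0))"

definition verblunsky :: "complex measure \<Rightarrow> nat \<Rightarrow> complex" where
  "verblunsky mu n = - cnj (poly (OPUC mu (Suc n)) 0)"

definition zero_mset :: "complex poly \<Rightarrow> complex multiset" where
  "zero_mset p = Abs_multiset (\<lambda>z. if p = 0 then 0 else order z p)"

definition zero_counting_measure :: "complex measure \<Rightarrow> nat \<Rightarrow> complex measure" where
  "zero_counting_measure mu n = measure_pmf (pmf_of_multiset (zero_mset (OPUC mu n)))"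

text \<open>Uniform probability measure on the circle {|z| = r} (Dirac at 0 if r = 0).\<close>
definition circle_uniform :: "real \<Rightarrow> complex measure" where
  "circle_uniform r = distr (uniform_measure lborel {0..2*pi}) borel (\<lambda>t. complex_of_real r * cis t)"

definition weak_conv_c :: "(nat \<Rightarrow> complex measure) \<Rightarrow> complex measure \<Rightarrow> bool" where
  "weak_conv_c Ms M \<longleftrightarrow> (\<forall>f :: complex \<Rightarrow> real. continuous_on UNIV f \<and> bounded (range f) \<longrightarrow>
      (\<lambda>n. \<integral>x. f x \<partial>Ms n) \<longlonglongrightarrow> (\<integral>x. f x \<partial>M))"

end

theory Submission
  imports Defs "HOL-Complex_Analysis.Complex_Analysis"
    "HOL-Computational_Algebra.Fundamental_Theorem_Algebra"
    "HOL-Real_Asymp.Real_Asymp"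
begin

text \<open>
  All zeros of \<open>\<Phi>\<^sub>n\<close> lie in the unit disk, so it suffices to test weak convergence on the monomials
  \<open>z\<^sup>a cnj z\<^sup>b\<close>, and these are controlled by two facts.

  Radii: the Szego recursion gives \<open>limsup |\<Phi>\<^sub>n(z)|\<^sup>1\<^sup>/\<^sup>n \<le> max \<rho> r\<close> uniformly on \<open>|z| = \<rho>\<close>, and the
  maximum principle turns this into an upper bound for the mean of \<open>ln (max |z\<^sub>i| \<rho>)\<close> over the zeros
  \<open>z\<^sub>i\<close>. Since the mean of \<open>ln |z\<^sub>i|\<close> is \<open>ln |\<alpha>\<^sub>n\<^sub>-\<^sub>1| / n \<longlonglongrightarrow> ln r\<close>, the moduli \<open>|z\<^sub>i|\<close> converge to \<open>r\<close> in mean.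

  Angles: the reversed polynomial is \<open>\<Phi>\<^sub>n\<^sup>*(z) = \<Prod>\<^sub>i (1 - cnj z\<^sub>i z)\<close>, so the power sums of the zeros are Taylor
  coefficients of \<open>log \<Phi>\<^sub>n\<^sup>*\<close>. The recursion writes \<open>\<Phi>\<^sub>n\<^sup>*\<close> as a product of factors
  \<open>1 - \<alpha>\<^sub>j z f\<^sub>j(z)\<close> with \<open>|f\<^sub>j| \<le> 1\<close> on the disk, which bounds the logarithm by a multiple of
  \<open>\<Sum>\<^sub>j\<^sub><\<^sub>n |\<alpha>\<^sub>j| = o(n)\<close>. Hence all power means of the zeros tend to \<open>0\<close>.
\<close>

section \<open>Zeros of polynomials\<close>

text \<open>The Szego reversal. Its degree drops when \<open>p\<close> vanishes at \<open>0\<close>,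
  so only an upper bound on it is available.\<close>

definition rev_poly :: "complex poly \<Rightarrow> complex poly" where
  "rev_poly p = reflect_poly (map_poly cnj p)"

lemma degree_map_poly_cnj [simp]: "degree (map_poly cnj p) = degree p"
  by (rule degree_map_poly) auto

lemma poly_map_poly_cnj: "poly (map_poly cnj p) z = cnj (poly p (cnj z))"
  using poly_cnj[of p "cnj z"] by simp

lemma poly_rev_poly:
  assumes "z \<noteq> 0"
  shows "poly (rev_poly p) z = z ^ degree p * cnj (poly p (1 / cnj z))"
  using assms by (simp add: rev_poly_def poly_reflect_poly_nz poly_map_poly_cnj inverse_eq_divide)

lemma poly_rev_poly_0: "poly (rev_poly p) 0 = cnj (lead_coeff p)"
  by (simp add: rev_poly_def coeff_map_poly)

lemma degree_rev_poly_le: "degree (rev_poly p) \<le> degree p"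
  using degree_reflect_poly_le[of "map_poly cnj p"] by (simp add: rev_poly_def)

lemma cnj_mult_circle:
  assumes "norm z = 1" shows "cnj z * z = 1"
  using assms complex_norm_square[of z] by (simp add: mult.commute)

lemma one_div_cnj:
  assumes "norm z = 1" shows "1 / cnj z = z"
proof -
  have "cnj z \<noteq> 0" using assms by auto
  then show ?thesis using cnj_mult_circle[OF assms] by (simp add: divide_eq_eq mult.commute)
qed

lemma poly_rev_poly_circle:
  assumes "norm z = 1"
  shows "poly (rev_poly p) z = z ^ degree p * cnj (poly p z)"
proof -
  have "z \<noteq> 0" using assms by auto
  then show ?thesis using poly_rev_poly[of z p] one_div_cnj[OF assms] by simp
qed

text \<open>One enumeration with multiplicity serves both the factorisation and the multiset behind
  the counting measure, so that integrals become finite sums.\<close>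

lemma monic_poly_zeros:
  assumes "degree p = n" "lead_coeff p = 1"
  obtains z :: "nat \<Rightarrow> complex" where "p = (\<Prod>i<n. [:- z i, 1:])"
    and "zero_mset p = image_mset z (mset_set {..<n})"
proof -
  have zp: "zero_mset p = proots p" by (simp add: zero_mset_def proots_def id_def)
  obtain xs where xs: "mset xs = proots p" using ex_mset by blast
  then have len: "length xs = n" using assms size_proots_complex[of p] by (metis size_mset)
  have im: "image_mset ((!) xs) (mset_set {..<n}) = mset xs"
    using len by (metis map_nth mset_map mset_upt atLeast0LessThan)
  have "p = (\<Prod>x\<in>#image_mset ((!) xs) (mset_set {..<n}). [:-x, 1:])"
    using complex_poly_decompose_multiset[of p] assms xs im by simp
  also have "\<dots> = (\<Prod>i<n. [:- (xs ! i), 1:])"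
    by (simp add: prod_unfold_prod_mset image_mset.compositionality o_def)
  finally show thesis using that zp xs im by metis
qed

lemma integral_pmf_of_multiset_image:
  fixes f :: "complex \<Rightarrow> real" and z :: "nat \<Rightarrow> complex"
  assumes "n > 0"
  shows "(\<integral>x. f x \<partial>measure_pmf (pmf_of_multiset (image_mset z (mset_set {..<n})))) = (\<Sum>i<n. f (z i)) / n"
proof -
  have ne: "{..<n} \<noteq> {}" using assms by auto
  have "pmf_of_multiset (image_mset z (mset_set {..<n})) = map_pmf z (pmf_of_set {..<n})"
    using ne by (intro map_pmf_of_set [symmetric]) auto
  then show ?thesis using ne by (simp add: integral_pmf_of_set)
qed

section \<open>Estimates for zeros: moduli and power sums\<close>

text \<open>Reflecting the zeros inside the circle to the outside does not change the modulus on the circle,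
  and the maximum principle is then applied at the origin. This replaces Jensen's formula.\<close>

lemma prod_max_le_sup_circle:
  fixes z :: "nat \<Rightarrow> complex"
  assumes "\<rho> > 0" and B: "\<And>w. norm w = \<rho> \<Longrightarrow> norm (\<Prod>i<n. w - z i) \<le> B"
  shows "(\<Prod>i<n. max (norm (z i)) \<rho>) \<le> B"
proof -
  \<comment> \<open>At the origin a reflected factor has modulus \<open>\<rho>\<close> and any other
    factor has modulus \<open>norm (z i)\<close>, so \<open>norm (q 0)\<close> is the product of the
    maxima.\<close>
  define q where "q w = (\<Prod>i<n. if norm (z i) \<le> \<rho> then (\<rho>\<^sup>2 - cnj (z i) * w) / \<rho> else w - z i)" for w
  have bd: "norm (q w) \<le> B" if "w \<in> frontier (cball 0 \<rho>)" for w
  proof -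
    have w: "norm w = \<rho>" using that by simp
    have f: "norm ((\<rho>\<^sup>2 - cnj y * w) / \<rho>) = norm (w - y)" for y
    proof -
      have "\<rho>\<^sup>2 - cnj y * w = cnj (w - y) * w"
        using w complex_norm_square[of w] by (simp add: algebra_simps)
      then show ?thesis
        using w assms(1) by (simp add: norm_divide norm_mult del: complex_cnj_diff)
    qed
    have "norm (q w) = norm (\<Prod>i<n. w - z i)"
      unfolding q_def prod_norm [symmetric] by (intro prod.cong refl) (use f in auto)
    then show ?thesis using B[OF w] by simp
  qed
  have "q holomorphic_on UNIV"
    unfolding q_def
  proof (rule holomorphic_on_prod)
    fix i
    show "(\<lambda>w. if norm (z i) \<le> \<rho> then (\<rho>\<^sup>2 - cnj (z i) * w) / \<rho> else w - z i) holomorphic_on UNIV"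
      using assms(1) by (cases "norm (z i) \<le> \<rho>") (auto intro!: holomorphic_intros)
  qed
  then have "q holomorphic_on interior (cball 0 \<rho>)" "continuous_on (closure (cball 0 \<rho>)) q"
    using holomorphic_on_subset holomorphic_on_imp_continuous_on by blast+
  then have "norm (q 0) \<le> B"
    by (rule maximum_modulus_frontier[OF _ _ bounded_cball bd]) (use assms(1) in simp_all)
  moreover have "norm (q 0) = (\<Prod>i<n. max (norm (z i)) \<rho>)"
    unfolding q_def prod_norm [symmetric] using assms(1)
    by (intro prod.cong refl) (auto simp: norm_divide norm_power power2_eq_square)
  ultimately show ?thesis by simp
qed

text \<open>The difference of the squared moduli factors as
  \<open>(1 - (norm w)\<^sup>2) * (1 - (norm z)\<^sup>2)\<close>.\<close>

lemma norm_diff_le_norm_rev: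
  fixes w z :: complex
  assumes "norm w \<le> 1" "norm z \<le> 1"
  shows "norm (w - z) \<le> norm (1 - cnj z * w)"
proof -
  have "(norm (1 - cnj z * w))\<^sup>2 - (norm (w - z))\<^sup>2 = (1 - (norm w)\<^sup>2) * (1 - (norm z)\<^sup>2)"
    unfolding cmod_power2 by (simp add: power2_eq_square algebra_simps)
  also have "\<dots> \<ge> 0" using assms by (simp add: abs_square_le_1)
  finally show ?thesis by (metis diff_ge_0_iff_ge norm_ge_zero power2_le_imp_le)
qed

text \<open>With \<open>t = ln (x / r)\<close> the right-hand side is
  \<open>2 * max t 0 - t\<close>, the absolute value of \<open>t\<close>, and on
  \<open>(0, 1]\<close> the logarithm does not shrink distances. This form separates the positive
  part, which is only bounded from above, from the plain logarithm, whose mean has a known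
  limit.\<close>

lemma abs_diff_le_ln:
  fixes x r :: real
  assumes "0 < x" "x \<le> 1" "0 < r" "r \<le> 1"
  shows "\<bar>x - r\<bar> \<le> 2 * ln (max x r / r) - ln (x / r)"
proof -
  have *: "b - a \<le> ln b - ln a" if "0 < a" "a \<le> b" "b \<le> 1" for a b :: real
  proof -
    have "ln (a / b) \<le> a / b - 1" using that by (intro ln_le_minus_one) auto
    then have "1 - a / b \<le> ln b - ln a" using that by (simp add: ln_div)
    moreover have "b - a \<le> 1 - a / b"
      using that mult_left_le[of b "b - a"] by (simp add: field_simps)
    ultimately show ?thesis by linarith
  qed
  show ?thesis
    using *[of x r] *[of r x] assms by (cases "x \<le> r") (auto simp: ln_div max_def)
qed

text \<open>At \<open>0\<close>, the derivative of order \<open>Suc k\<close> of any holomorphic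
  logarithm of the product is \<open>- fact k\<close> times the power sum, and Cauchy's inequality
  bounds it. The value \<open>L 0\<close> is left free.\<close>

lemma power_sum_bound_of_log:
  fixes c :: "nat \<Rightarrow> complex"
  assumes hol: "L holomorphic_on ball 0 (1/2)"
    and B: "\<And>w. norm w < 1/2 \<Longrightarrow> norm (L w) \<le> B"
    and ex: "\<And>w. norm w < 1/2 \<Longrightarrow> exp (L w) = (\<Prod>i<n. 1 - c i * w)"
    and c: "\<And>i. i < n \<Longrightarrow> norm (c i) \<le> 1"
  shows "norm (\<Sum>i<n. c i ^ Suc k) \<le> fact (Suc k) * 4 ^ Suc k * B"
proof -
  have small: "norm (c i * w) < 1/2" if "i < n" "norm w < 1/2" for i w
    using c[OF that(1)] that(2) mult_right_mono[of "norm (c i)" 1 "norm w"] by (simp add: norm_mult)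
  have re: "Re (1 - c i * w) > 0" if "i < n" "norm w < 1/2" for i w
    using small[OF that] abs_Re_le_cmod[of "c i * w"] by (simp del: times_complex.sel)
  have ne: "1 - c i * w \<noteq> 0" if "i < n" "norm w < 1/2" for i w
    using re[OF that] by fastforce
  \<comment> \<open>\<open>G\<close> is the sum of principal branches, which are holomorphic here
    because every factor has positive real part; \<open>H k\<close> is its derivative of order
    \<open>Suc k\<close>.\<close>
  define G where "G w = (\<Sum>i<n. Ln (1 - c i * w))" for w
  define H where "H k w = (\<Sum>i<n. - fact k * c i ^ Suc k / (1 - c i * w) ^ Suc k)" for k w
  have dG: "(G has_field_derivative H 0 w) (at w)" if "norm w < 1/2" for w
  proof -
    have "1 - c i * w \<notin> \<real>\<^sub>\<le>\<^sub>0" if "i < n" for i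
      using re[OF that \<open>norm w < 1/2\<close>] by (auto simp: complex_nonpos_Reals_iff)
    then show ?thesis unfolding G_def H_def
      by (auto intro!: derivative_eq_intros sum.cong simp: divide_simps)
  qed
  have dH: "(H k has_field_derivative H (Suc k) w) (at w)" if "norm w < 1/2" for w k
    unfolding H_def
  proof (rule DERIV_sum)
    fix i assume i: "i \<in> {..<n}"
    then have nz: "1 - c i * w \<noteq> 0" using ne that by auto
    let ?d = "1 - c i * w"
    have "((\<lambda>w. - fact k * c i ^ Suc k * inverse ((1 - c i * w) ^ Suc k)) has_field_derivative
        - fact k * c i ^ Suc k * (- (inverse (?d ^ Suc k) * (of_nat (Suc k) * (- c i) * ?d ^ k) * inverse (?d ^ Suc k)))) (at w)"
      by (rule derivative_eq_intros refl | use nz in \<open>simp add: algebra_simps; fail\<close>)+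
    moreover have "- fact k * c i ^ Suc k * (- (inverse (?d ^ Suc k) * (of_nat (Suc k) * (- c i) * ?d ^ k) * inverse (?d ^ Suc k)))
       = - fact (Suc k) * c i ^ Suc (Suc k) / ?d ^ Suc (Suc k)"
      using nz by (simp add: divide_simps)
    ultimately have "((\<lambda>w. - fact k * c i ^ Suc k * inverse ((1 - c i * w) ^ Suc k)) has_field_derivative
        - fact (Suc k) * c i ^ Suc (Suc k) / ?d ^ Suc (Suc k)) (at w)" by (simp only:)
    then show "((\<lambda>w. - fact k * c i ^ Suc k / (1 - c i * w) ^ Suc k) has_field_derivative
        - fact (Suc k) * c i ^ Suc (Suc k) / ?d ^ Suc (Suc k)) (at w)"
      unfolding divide_inverse .
  qed
  \<comment> \<open>Two logarithms of the same function have the same derivative, so the Taylor coefficients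
    of \<open>L\<close> are the power sums, up to normalisation.\<close>
  have dL: "(L has_field_derivative H 0 w) (at w)" if w: "norm w < 1/2" for w
  proof -
    have L: "(L has_field_derivative deriv L w) (at w)"
      using hol w by (intro holomorphic_derivI[of _ "ball 0 (1/2)"]) auto
    have "exp (L v - G v) = 1" if "v \<in> ball 0 (1/2)" for v
    proof -
      have "exp (G v) = (\<Prod>i<n. 1 - c i * v)"
        unfolding G_def using ne that by (simp add: exp_sum)
      then have "exp (G v) = exp (L v)" using ex[of v] that by simp
      then show ?thesis by (simp add: exp_diff)
    qed
    then have "((\<lambda>v. exp (L v - G v)) has_field_derivative 0) (at w)"
      using w by (intro has_field_derivative_transform_within_open[OF DERIV_const[of 1], where S = "ball 0 (1/2)"]) auto
    moreover have "((\<lambda>v. exp (L v - G v)) has_field_derivative exp (L w - G w) * (deriv L w - H 0 w)) (at w)"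
      by (rule derivative_eq_intros L dG w refl)+
    ultimately have "exp (L w - G w) * (deriv L w - H 0 w) = 0" using DERIV_unique by blast
    then show ?thesis using L by simp
  qed
  have derivs: "(deriv ^^ Suc k) L w = H k w" if "norm w < 1/2" for k w
    using that
  proof (induction k arbitrary: w)
    case 0
    then show ?case using dL by (simp add: DERIV_imp_deriv)
  next
    case (Suc k)
    have "((deriv ^^ Suc k) L has_field_derivative H (Suc k) w) (at w)"
      using Suc by (intro has_field_derivative_transform_within_open[OF dH, where S = "ball 0 (1/2)"]) auto
    then show ?case by (simp add: DERIV_imp_deriv)
  qed
  \<comment> \<open>Radius \<open>1/4\<close> keeps the closed disk inside the region where
    \<open>L\<close> is bounded by \<open>B\<close>; it is the source of the power of
    \<open>4\<close>.\<close>
  have "norm ((deriv ^^ Suc k) L 0) \<le> fact (Suc k) * B / (1/4) ^ Suc k"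
  proof (rule Cauchy_inequality)
    show "L holomorphic_on ball 0 (1/4)" by (rule holomorphic_on_subset[OF hol]) auto
    show "continuous_on (cball 0 (1/4)) L"
      by (rule continuous_on_subset[OF holomorphic_on_imp_continuous_on[OF hol]]) auto
  qed (auto intro!: B)
  also have "(deriv ^^ Suc k) L 0 = H k 0" by (rule derivs) simp
  finally have "norm (H k 0) \<le> fact (Suc k) * 4 ^ Suc k * B"
    by (simp add: power_divide algebra_simps)
  moreover have "H k 0 = - fact k * (\<Sum>i<n. c i ^ Suc k)" by (simp add: H_def sum_distrib_left)
  then have "norm (H k 0) = fact k * norm (\<Sum>i<n. c i ^ Suc k)" by (simp add: norm_mult)
  moreover have "fact k * norm (\<Sum>i<n. c i ^ Suc k) \<ge> norm (\<Sum>i<n. c i ^ Suc k)"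
    using mult_right_mono[of 1 "fact k :: real" "norm (\<Sum>i<n. c i ^ Suc k)"] by (simp add: fact_ge_1)
  ultimately show ?thesis by linarith
qed

section \<open>Equidistribution on a circle\<close>

text \<open>Polynomials in \<open>z\<close> and \<open>cnj z\<close>. Closure under products is
  derived and not a constructor, because means and integrals are linear but not
  multiplicative.\<close>

inductive bipoly :: "(complex \<Rightarrow> complex) \<Rightarrow> bool" where
  monomial: "bipoly (\<lambda>z. c * (z ^ a * cnj z ^ b))"
| add: "bipoly f \<Longrightarrow> bipoly g \<Longrightarrow> bipoly (\<lambda>z. f z + g z)"

lemma bipoly_mult:
  assumes "bipoly f" "bipoly g"
  shows "bipoly (\<lambda>z. f z * g z)"
  using assms
proof (induction f)
  case (monomial c a b)
  from \<open>bipoly g\<close> show ?case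
  proof (induction g)
    case (monomial c' a' b')
    have "(\<lambda>z. c * (z ^ a * cnj z ^ b) * (c' * (z ^ a' * cnj z ^ b')))
        = (\<lambda>z. (c * c') * (z ^ (a + a') * cnj z ^ (b + b')))"
      by (simp add: power_add mult_ac)
    then show ?case using bipoly.monomial by metis
  next
    case (add f g)
    then show ?case by (auto simp: distrib_left intro: bipoly.add)
  qed
next
  case (add f1 f2)
  then show ?case by (auto simp: distrib_right intro: bipoly.add)
qed

lemma bipoly_of_real_polynomial_function:
  assumes "real_polynomial_function g"
  shows "bipoly (\<lambda>z. complex_of_real (g z))"
  using assms
proof (induction g)
  case (linear f)
  interpret bounded_linear f by fact
  \<comment> \<open>A real-linear functional on the plane has the form
    \<open>c * z + cnj c * cnj z\<close>; its values at \<open>1\<close> and \<open>\<i>\<close>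
    force this \<open>c\<close>.\<close>
  define c where "c = (complex_of_real (f 1) - \<i> * complex_of_real (f \<i>)) / 2"
  have "complex_of_real (f z) = c * (z ^ 1 * cnj z ^ 0) + cnj c * (z ^ 0 * cnj z ^ 1)" for z
  proof -
    have "z = Re z *\<^sub>R 1 + Im z *\<^sub>R \<i>" by (simp add: complex_eq_iff)
    then have "f z = Re z * f 1 + Im z * f \<i>" by (metis add scaleR real_scaleR_def)
    then show ?thesis by (simp add: c_def complex_eq_iff field_simps)
  qed
  then show ?case using bipoly.add[OF bipoly.monomial bipoly.monomial, of c 1 0 "cnj c" 0 1] by simp
next
  case (const c)
  show ?case using bipoly.monomial[of "complex_of_real c" 0 0] by simp
next
  case (add f g)
  then show ?case by (simp add: bipoly.add)
next
  case (mult f g)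
  then show ?case by (simp add: bipoly_mult)
qed

lemma bipoly_continuous: "bipoly f \<Longrightarrow> continuous_on A f"
  by (induction rule: bipoly.induct) (auto intro!: continuous_intros)

section \<open>Integration over the circle\<close>

abbreviation unif_angle :: "real measure" where
  "unif_angle \<equiv> uniform_measure lborel {0..2 * pi}"

lemma prob_space_unif_angle: "prob_space unif_angle"
  by (rule prob_space_uniform_measure) auto

lemma measurable_unif_angle:
  assumes "continuous_on UNIV g" shows "g \<in> borel_measurable unif_angle"
proof -
  have "borel_measurable unif_angle = borel_measurable borel" by (rule measurable_cong_sets) auto
  then show ?thesis using borel_measurable_continuous_onI[OF assms] by simp
qed

lemma integral_unif_angle:
  fixes g :: "real \<Rightarrow> complex"
  assumes "continuous_on UNIV g"
  shows "integral\<^sup>L unif_angle g = integral {0..2 * pi} g / (2 * pi)"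
proof -
  have eq: "unif_angle = density lborel (\<lambda>x. ennreal (indicator {0..2 * pi} x / (2 * pi)))"
    unfolding uniform_measure_def
    by (intro arg_cong2[of _ _ _ _ density] refl ext)
       (auto simp: indicator_def divide_ennreal ennreal_1 simp flip: ennreal_1)
  have "integral\<^sup>L unif_angle g = (\<integral>x. (indicator {0..2 * pi} x / (2 * pi)) *\<^sub>R g x \<partial>lborel)"
    unfolding eq using assms
    by (intro integral_density) (auto intro: borel_measurable_continuous_onI)
  also have "\<dots> = (\<integral>x. (indicator {0..2 * pi} x *\<^sub>R g x) / (2 * pi) \<partial>lborel)"
    by (intro Bochner_Integration.integral_cong refl) (simp add: scaleR_conv_of_real)
  also have "\<dots> = (LINT x : {0..2 * pi} | lborel. g x) / (2 * pi)"
    unfolding set_lebesgue_integral_def by simp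
  also have "(LINT x : {0..2 * pi} | lborel. g x) = integral {0..2 * pi} g"
    using assms by (intro set_borel_integral_eq_integral borel_integrable_atLeastAtMost')
      (auto intro: continuous_on_subset)
  finally show ?thesis .
qed

text \<open>The antiderivative \<open>cis (k * t) / (\<i> * k)\<close> has period
  \<open>2 * pi\<close>.\<close>

lemma integral_cis_multiple:
  assumes "k > 0"
  shows "integral {0..2 * pi} (\<lambda>t. cis (real k * t)) = 0"
proof -
  have "((\<lambda>t. cis (real k * t)) has_integral
      cis (real k * (2 * pi)) / (\<i> * k) - cis (real k * 0) / (\<i> * k)) {0..2 * pi}"
  proof (rule fundamental_theorem_of_calculus)
    fix t
    show "((\<lambda>t. cis (real k * t) / (\<i> * k)) has_vector_derivative cis (real k * t)) (at t within {0..2 * pi})"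
      unfolding has_vector_derivative_def using assms
      by (auto intro!: derivative_eq_intros simp: scaleR_conv_of_real)
         (simp add: fun_eq_iff complex_eq_iff)
  qed simp
  moreover have "cis (real k * (2 * pi)) = 1"
    using cis_multiple_2pi[of "real k"] by (simp add: mult_ac)
  ultimately show ?thesis by (simp add: integral_unique)
qed

lemma integrable_unif_angle_circle:
  fixes h :: "complex \<Rightarrow> 'a :: {banach, second_countable_topology}"
  assumes "continuous_on UNIV h"
  shows "integrable unif_angle (\<lambda>t. h (complex_of_real r * cis t))"
proof -
  interpret prob_space unif_angle by (rule prob_space_unif_angle)
  have "compact (h ` cball 0 \<bar>r\<bar>)"
    by (intro compact_continuous_image continuous_on_subset[OF assms]) auto
  then obtain B where "\<forall>w \<in> h ` cball 0 \<bar>r\<bar>. norm w \<le> B"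
    using compact_imp_bounded[of "h ` cball 0 \<bar>r\<bar>"] bounded_iff[of "h ` cball 0 \<bar>r\<bar>"] by metis
  then show ?thesis
    by (intro integrable_const_bound[of _ B] measurable_unif_angle)
       (auto intro!: continuous_on_compose2[OF assms] continuous_intros simp: norm_mult)
qed

lemma integral_circle_uniform:
  fixes f :: "complex \<Rightarrow> 'a :: {banach, second_countable_topology}"
  assumes "continuous_on UNIV f"
  shows "integral\<^sup>L (circle_uniform r) f = (\<integral>t. f (r * cis t) \<partial>unif_angle)"
  unfolding circle_uniform_def using assms
  by (intro integral_distr)
     (auto intro!: borel_measurable_continuous_onI measurable_unif_angle continuous_intros)

text \<open>The integrand is \<open>r ^ (2 * b + k) * cis (k * t)\<close>, which averages to zero
  over a full turn unless \<open>k = 0\<close>.\<close>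

lemma integral_unif_angle_monomial:
  "(\<integral>t. (complex_of_real r * cis t) ^ (b + k) * cnj (complex_of_real r * cis t) ^ b \<partial>unif_angle)
    = (if k = 0 then complex_of_real r ^ (2 * b) else 0)"
proof -
  interpret prob_space unif_angle by (rule prob_space_unif_angle)
  have eq: "(complex_of_real r * cis t) ^ (b + k) * cnj (complex_of_real r * cis t) ^ b
      = complex_of_real r ^ (2 * b + k) * cis (real k * t)" for t
  proof -
    have "cis t ^ b * cnj (cis t) ^ b = 1"
      by (metis cis_cnj cis_mult add.right_inverse cis_zero power_mult_distrib power_one)
    moreover have "(complex_of_real r * cis t) ^ (b + k) * cnj (complex_of_real r * cis t) ^ b
      = complex_of_real r ^ (2 * b + k) * (cis t ^ b * cnj (cis t) ^ b) * cis t ^ k"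
      by (simp only: power_mult_distrib power_add mult_2 mult_2_right mult_ac complex_cnj_mult complex_cnj_complex_of_real)
    ultimately show ?thesis by (simp add: Complex.DeMoivre)
  qed
  show ?thesis
  proof (cases "k = 0")
    case True
    then show ?thesis unfolding eq by (simp add: prob_space)
  next
    case False
    have "(\<integral>t. cis (real k * t) \<partial>unif_angle) = 0"
      using False by (subst integral_unif_angle) (auto intro!: continuous_intros simp: integral_cis_multiple)
    then show ?thesis unfolding eq using False by simp
  qed
qed

text \<open>Convergence of the radii replaces \<open>z ^ (b + k) * cnj z ^ b\<close> by
  \<open>r ^ (2 * b) * z ^ k\<close> in the means, and the moments settle the latter.
  Stone-Weierstrass on the closed unit disk, which contains all the points, extends this to
  continuous \<open>f\<close>.\<close>

lemma mean_tendsto_circle_uniform: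
  fixes z :: "nat \<Rightarrow> nat \<Rightarrow> complex" and f :: "complex \<Rightarrow> real"
  assumes r: "0 \<le> r" "r \<le> 1"
    and z: "\<And>n i. i < n \<Longrightarrow> norm (z n i) \<le> 1"
    and radius: "(\<lambda>n. (\<Sum>i<n. \<bar>norm (z n i) - r\<bar>) / n) \<longlonglongrightarrow> 0"
    and moments: "\<And>k. (\<lambda>n. (\<Sum>i<n. z n i ^ Suc k) / n) \<longlonglongrightarrow> 0"
    and f: "continuous_on UNIV f"
  shows "(\<lambda>n. (\<Sum>i<n. f (z n i)) / n) \<longlonglongrightarrow> integral\<^sup>L (circle_uniform r) f"
proof -
  interpret prob_space unif_angle by (rule prob_space_unif_angle)
  define A where "A g n = (\<Sum>i<n. g (z n i)) / of_nat n" for g :: "complex \<Rightarrow> complex" and n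
  define I where "I g = (\<integral>t. g (r * cis t) \<partial>unif_angle)" for g :: "complex \<Rightarrow> complex"
  have half: "A (\<lambda>z. z ^ (b + k) * cnj z ^ b) \<longlonglongrightarrow> I (\<lambda>z. z ^ (b + k) * cnj z ^ b)" for b k
  proof -
    have Ak: "(\<lambda>n. A (\<lambda>z. z ^ k) n) \<longlonglongrightarrow> (if k = 0 then 1 else 0)"
    proof (cases k)
      case 0
      \<comment> \<open>The mean of ones is \<open>1\<close> only for \<open>n > 0\<close>; at
        \<open>n = 0\<close> it is \<open>0 / 0 = 0\<close>.\<close>
      have "eventually (\<lambda>n. A (\<lambda>z. z ^ k) n = 1) sequentially"
        using eventually_gt_at_top[of 0] by eventually_elim (simp add: A_def 0)
      then show ?thesis using 0 by (simp add: tendsto_eventually)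
    next
      case (Suc k)
      then show ?thesis using moments[of k] by (simp add: A_def)
    qed
    \<comment> \<open>The power with exponent \<open>2 * b\<close> is Lipschitz on
      \<open>[0, 1]\<close> with constant \<open>2 * b\<close>, so the error is controlled by the
      mean radial deviation.\<close>
    have "(\<lambda>n. A (\<lambda>z. z ^ (b + k) * cnj z ^ b) n - of_real r ^ (2 * b) * A (\<lambda>z. z ^ k) n) \<longlonglongrightarrow> 0"
    proof (rule Lim_null_comparison)
      show "(\<lambda>n. real (2 * b) * ((\<Sum>i<n. \<bar>norm (z n i) - r\<bar>) / n)) \<longlonglongrightarrow> 0"
        by (rule tendsto_mult_right_zero[OF radius])
      show "eventually (\<lambda>n. norm (A (\<lambda>z. z ^ (b + k) * cnj z ^ b) n - of_real r ^ (2 * b) * A (\<lambda>z. z ^ k) n)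
        \<le> real (2 * b) * ((\<Sum>i<n. \<bar>norm (z n i) - r\<bar>) / n)) sequentially"
      proof (intro always_eventually allI)
        fix n
        have pt: "norm (w ^ (b + k) * cnj w ^ b - of_real r ^ (2 * b) * w ^ k) \<le> real (2 * b) * \<bar>norm w - r\<bar>"
          if w: "norm w \<le> 1" for w :: complex
        proof -
          have "w ^ b * cnj w ^ b = of_real (norm w) ^ (2 * b)"
            using complex_norm_square[of w] by (simp add: power_mult flip: power_mult_distrib)
          then have "w ^ (b + k) * cnj w ^ b = of_real (norm w) ^ (2 * b) * w ^ k"
            by (simp add: power_add mult_ac)
          then have "w ^ (b + k) * cnj w ^ b - of_real r ^ (2 * b) * w ^ k
              = of_real (norm w ^ (2 * b) - r ^ (2 * b)) * w ^ k" by (simp add: algebra_simps)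
          then have "norm (w ^ (b + k) * cnj w ^ b - of_real r ^ (2 * b) * w ^ k)
              = \<bar>norm w ^ (2 * b) - r ^ (2 * b)\<bar> * norm w ^ k" 
            by (simp only: norm_mult norm_of_real norm_power)
          also have "\<dots> \<le> \<bar>norm w ^ (2 * b) - r ^ (2 * b)\<bar> * 1"
            using w by (intro mult_left_mono power_le_one) auto
          also have "\<dots> \<le> real (2 * b) * \<bar>norm w - r\<bar>"
            using norm_power_diff[of "norm w" r "2 * b"] w r by simp
          finally show ?thesis .
        qed
        have "A (\<lambda>z. z ^ (b + k) * cnj z ^ b) n - of_real r ^ (2 * b) * A (\<lambda>z. z ^ k) n
          = (\<Sum>i<n. z n i ^ (b + k) * cnj (z n i) ^ b - of_real r ^ (2 * b) * z n i ^ k) / n"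
          by (simp add: A_def sum_subtractf sum_distrib_left diff_divide_distrib)
        also have "norm \<dots> \<le> (\<Sum>i<n. real (2 * b) * \<bar>norm (z n i) - r\<bar>) / n"
          unfolding norm_divide norm_of_nat
          by (intro divide_right_mono sum_norm_le pt z) auto
        finally show "norm (A (\<lambda>z. z ^ (b + k) * cnj z ^ b) n - of_real r ^ (2 * b) * A (\<lambda>z. z ^ k) n)
            \<le> real (2 * b) * ((\<Sum>i<n. \<bar>norm (z n i) - r\<bar>) / n)"
          by (simp add: sum_distrib_left)
      qed
    qed
    moreover have "(\<lambda>n. of_real r ^ (2 * b) * A (\<lambda>z. z ^ k) n) \<longlonglongrightarrow> of_real r ^ (2 * b) * (if k = 0 then 1 else 0)"
      by (intro tendsto_intros Ak)
    ultimately have "(\<lambda>n. A (\<lambda>z. z ^ (b + k) * cnj z ^ b) n) \<longlonglongrightarrow> of_real r ^ (2 * b) * (if k = 0 then 1 else 0)"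
      using Lim_transform by blast
    then show ?thesis unfolding I_def integral_unif_angle_monomial by (cases "k = 0") auto
  qed
  have mono: "A (\<lambda>z. z ^ a * cnj z ^ b) \<longlonglongrightarrow> I (\<lambda>z. z ^ a * cnj z ^ b)" for a b
  proof (cases "b \<le> a")
    case True
    then show ?thesis using half[of b "a - b"] by simp
  next
    case False
    \<comment> \<open>The case \<open>a < b\<close> is the complex conjugate of a case treated in
      \<open>half\<close>.\<close>
    have *: "(\<lambda>z. z ^ a * cnj z ^ b) = (\<lambda>z. cnj (z ^ (a + (b - a)) * cnj z ^ a))"
      using False by (auto simp: mult.commute)
    have "(\<lambda>n. cnj (A (\<lambda>z. z ^ (a + (b - a)) * cnj z ^ a) n)) \<longlonglongrightarrow> cnj (I (\<lambda>z. z ^ (a + (b - a)) * cnj z ^ a))"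
      by (rule tendsto_cnj[OF half])
    then show ?thesis unfolding * I_def Bochner_Integration.integral_cnj by (simp add: A_def [abs_def])
  qed
  have bip: "A g \<longlonglongrightarrow> I g" if "bipoly g" for g
    using that
  proof (induction g)
    case (monomial c a b)
    have "A (\<lambda>z. c * (z ^ a * cnj z ^ b)) = (\<lambda>n. c * A (\<lambda>z. z ^ a * cnj z ^ b) n)"
      by (simp add: A_def fun_eq_iff sum_distrib_left)
    moreover have "I (\<lambda>z. c * (z ^ a * cnj z ^ b)) = c * I (\<lambda>z. z ^ a * cnj z ^ b)"
      unfolding I_def by (rule integral_mult_right_zero)
    ultimately show ?case using tendsto_mult_left[OF mono] by metis
  next
    case (add g h)
    have "A (\<lambda>z. g z + h z) = (\<lambda>n. A g n + A h n)"
      by (simp add: A_def fun_eq_iff sum.distrib add_divide_distrib)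
    moreover have "I (\<lambda>z. g z + h z) = I g + I h"
      unfolding I_def
      by (intro Bochner_Integration.integral_add integrable_unif_angle_circle bipoly_continuous add.hyps)
    ultimately show ?case using tendsto_add[OF add.IH] by metis
  qed
  show ?thesis
  proof (rule LIMSEQ_I)
    fix e :: real assume "e > 0"
    \<comment> \<open>Three errors of at most \<open>e / 4\<close> will occur: \<open>f\<close>
      against \<open>g\<close> in the means, the means of \<open>g\<close> against their limit, and
      \<open>g\<close> against \<open>f\<close> in the integral.\<close>
    then have e: "e / 4 > 0" by simp
    obtain g where g: "real_polynomial_function g" "\<And>x. x \<in> cball 0 1 \<Longrightarrow> \<bar>f x - g x\<bar> < e / 4"
      using Stone_Weierstrass_real_polynomial_function[OF compact_cball continuous_on_subset[OF f] e] by blast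
    have gc: "continuous_on UNIV g"
      using g(1) continuous_on_polymonial_function real_polynomial_function_eq by blast
    define J where "J h = (\<integral>t. h (r * cis t) \<partial>unif_angle)" for h :: "complex \<Rightarrow> real"
    define M where "M h n = (\<Sum>i<n. h (z n i)) / n" for h :: "complex \<Rightarrow> real" and n
    have "(\<lambda>n. complex_of_real (M g n)) \<longlonglongrightarrow> complex_of_real (J g)"
      using bip[OF bipoly_of_real_polynomial_function[OF g(1)]]
      by (simp add: A_def [abs_def] I_def J_def M_def)
    then have "M g \<longlonglongrightarrow> J g" by (simp only: tendsto_of_real_iff)
    then obtain N where N: "\<And>n. n \<ge> N \<Longrightarrow> \<bar>M g n - J g\<bar> < e / 4"
      using LIMSEQ_D[OF _ e] by (metis real_norm_def)
    have "\<bar>J f - J g\<bar> \<le> e / 4"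
    proof -
      have "J f - J g = (\<integral>t. f (r * cis t) - g (r * cis t) \<partial>unif_angle)"
        unfolding J_def by (intro Bochner_Integration.integral_diff [symmetric] integrable_unif_angle_circle f gc)
      also have "\<bar>\<dots>\<bar> \<le> (\<integral>t. \<bar>f (r * cis t) - g (r * cis t)\<bar> \<partial>unif_angle)"
        using integral_norm_bound[of unif_angle "\<lambda>t. f (r * cis t) - g (r * cis t)"] by simp
      also have "\<dots> \<le> (\<integral>t. e / 4 \<partial>unif_angle)"
        using g(2) r
        by (intro integral_mono integrable_abs Bochner_Integration.integrable_diff
              integrable_unif_angle_circle f gc)
           (auto intro!: less_imp_le simp: norm_mult)
      finally show ?thesis by (simp add: prob_space)
    qed
    have means: "\<bar>M f n - M g n\<bar> \<le> e / 4" if "n > 0" for n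
    proof -
      have "\<bar>\<Sum>i<n. f (z n i) - g (z n i)\<bar> \<le> (\<Sum>i<n. e / 4)"
        using g(2) z by (intro order_trans[OF sum_abs] sum_mono) (auto intro!: less_imp_le)
      then have "\<bar>\<Sum>i<n. f (z n i) - g (z n i)\<bar> / n \<le> e / 4" using that by (simp add: field_simps)
      then show ?thesis by (simp add: M_def sum_subtractf flip: diff_divide_distrib)
    qed
    \<comment> \<open>\<open>Suc N\<close> ensures \<open>n > 0\<close>, as \<open>means\<close>
      requires.\<close>
    have "norm (M f n - J f) < e" if "n \<ge> Suc N" for n
    proof -
      have "\<bar>M f n - M g n\<bar> \<le> e / 4" "\<bar>M g n - J g\<bar> < e / 4" "\<bar>J f - J g\<bar> \<le> e / 4"
        using \<open>\<bar>J f - J g\<bar> \<le> e / 4\<close> means N[of n] that by auto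
      then show ?thesis using \<open>e > 0\<close> unfolding real_norm_def by linarith
    qed
    then show "\<exists>no. \<forall>n\<ge>no. norm ((\<Sum>i<n. f (z n i)) / n - integral\<^sup>L (circle_uniform r) f) < e"
      unfolding integral_circle_uniform[OF f] M_def J_def by blast
  qed
qed

section \<open>Orthogonal polynomials on the unit circle\<close>

locale nontrivial_circle_measure = prob_space mu for mu :: "complex measure" +
  assumes sets_borel: "sets mu = sets borel"
    and null_off_circle: "emeasure mu (- sphere 0 1) = 0"
    and infinite_support: "infinite (msupport mu)"
begin

section \<open>The inner product on polynomials\<close>

abbreviation ip :: "(complex \<Rightarrow> complex) \<Rightarrow> (complex \<Rightarrow> complex) \<Rightarrow> complex" where
  "ip f g \<equiv> (\<integral>z. cnj (f z) * g z \<partial>mu)"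

lemma AE_circle: "AE z in mu. norm z = 1"
proof (rule AE_I)
  show "{z \<in> space mu. norm z \<noteq> 1} \<subseteq> - sphere 0 1" by auto
  show "- sphere 0 1 \<in> sets mu" unfolding sets_borel by auto
qed (rule null_off_circle)

text \<open>A continuous function is bounded on the compact circle, which carries all the
  mass.\<close>

lemma integrable_continuous:
  fixes f :: "complex \<Rightarrow> complex"
  assumes "continuous_on UNIV f"
  shows "integrable mu f"
proof -
  have "compact (f ` sphere 0 1)"
    using assms continuous_on_subset by (intro compact_continuous_image) auto
  then obtain B where B: "\<forall>w \<in> f ` sphere 0 1. norm w \<le> B"
    using compact_imp_bounded[of "f ` sphere 0 1"] bounded_iff[of "f ` sphere 0 1"] by metis
  have "f \<in> borel_measurable mu"
    using assms borel_measurable_continuous_onI measurable_cong_sets[OF sets_borel refl] by blast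
  moreover have "AE z in mu. norm (f z) \<le> B"
    using AE_circle by eventually_elim (use B in auto)
  ultimately show ?thesis by (rule integrable_const_bound[rotated])
qed

lemma integrable_poly_prod [simp]: "integrable mu (\<lambda>z. cnj (poly q z) * poly p z)"
  by (rule integrable_continuous) (intro continuous_intros)

lemma integrable_monom_poly [simp]: "integrable mu (\<lambda>z. cnj (z ^ j) * poly p z)"
  by (rule integrable_continuous) (intro continuous_intros)

definition orth :: "nat \<Rightarrow> complex poly \<Rightarrow> bool" where
  "orth n p \<longleftrightarrow> (\<forall>j<n. ip (\<lambda>z. z ^ j) (poly p) = 0)"

text \<open>Expand \<open>q\<close> in monomials. Stating the degree condition through coefficients
  also covers \<open>n = 0\<close>, where it forces \<open>q = 0\<close>.\<close>

lemma ip_orth: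
  assumes "orth n p" "\<And>i. i \<ge> n \<Longrightarrow> coeff q i = 0"
  shows "ip (poly q) (poly p) = 0"
proof -
  have "ip (poly q) (poly p) = (\<integral>z. (\<Sum>i\<le>degree q. cnj (coeff q i) * (cnj (z ^ i) * poly p z)) \<partial>mu)"
    by (simp add: poly_altdef sum_distrib_right mult.assoc)
  also have "\<dots> = (\<Sum>i\<le>degree q. cnj (coeff q i) * ip (\<lambda>z. z ^ i) (poly p))"
    by (subst Bochner_Integration.integral_sum)
       (auto intro!: integrable_continuous continuous_intros simp del: complex_cnj_power)
  also have "\<dots> = 0"
    using assms unfolding orth_def by (intro sum.neutral ballI) (metis complex_cnj_zero mult_eq_0_iff not_le)
  finally show ?thesis .
qed

lemma ip_self_eq: "ip (poly q) (poly q) = of_real (\<integral>z. (cmod (poly q z))\<^sup>2 \<partial>mu)"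
proof -
  have "ip (poly q) (poly q) = (\<integral>z. complex_of_real ((cmod (poly q z))\<^sup>2) \<partial>mu)"
    by (intro Bochner_Integration.integral_cong refl) (metis complex_norm_square mult.commute of_real_power)
  then show ?thesis by (simp only: integral_complex_of_real)
qed

lemma norm_sq_integrable: "integrable mu (\<lambda>z. (cmod (poly q z))\<^sup>2)"
proof -
  have "integrable mu (\<lambda>z. complex_of_real ((cmod (poly q z))\<^sup>2))"
    by (rule integrable_continuous) (intro continuous_intros)
  then show ?thesis using complex_of_real_integrable_eq by blast
qed

text \<open>Otherwise \<open>q\<close> vanishes almost everywhere, so every ball avoiding its
  finitely many zeros is null and the support of the measure is finite.\<close>

lemma ip_self_pos:
  assumes "q \<noteq> 0"
  shows "(\<integral>z. (cmod (poly q z))\<^sup>2 \<partial>mu) > 0"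
proof (rule ccontr)
  assume "\<not> ?thesis"
  moreover have "(\<integral>z. (cmod (poly q z))\<^sup>2 \<partial>mu) \<ge> 0" by simp
  ultimately have "(\<integral>z. (cmod (poly q z))\<^sup>2 \<partial>mu) = 0" by linarith
  then have ae: "AE z in mu. (cmod (poly q z))\<^sup>2 = 0"
    using integral_nonneg_eq_0_iff_AE[OF norm_sq_integrable] by simp
  let ?Z = "{z. poly q z = 0}"
  have fin: "finite ?Z" using assms poly_roots_finite by blast
  have "msupport mu \<subseteq> ?Z"
  proof
    fix z assume z: "z \<in> msupport mu"
    show "z \<in> ?Z"
    proof (rule ccontr)
      assume "z \<notin> ?Z"
      moreover have "open (- ?Z)" using fin by (simp add: finite_imp_closed open_Compl)
      ultimately obtain e where e: "e > 0" "ball z e \<subseteq> - ?Z"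
        by (metis ComplI open_contains_ball)
      have "AE w in mu. w \<notin> ball z e" using ae by eventually_elim (use e in auto)
      moreover have "ball z e \<in> sets mu" by (simp add: sets_borel)
      ultimately have "emeasure mu (ball z e) = 0" by (metis AE_iff_null_sets null_setsD1)
      then show False using z e(1) by (auto simp: msupport_def)
    qed
  qed
  then show False using infinite_support fin finite_subset by blast
qed

text \<open>\<open>q\<close> is a combination of monomials to which it is orthogonal, hence
  orthogonal to itself.\<close>

lemma orth_zero:
  assumes "orth n q" "\<And>i. i \<ge> n \<Longrightarrow> coeff q i = 0"
  shows "q = 0"
  using ip_orth[OF assms] ip_self_pos[of q] ip_self_eq[of q] by fastforce

lemma orth_diff:
  assumes "orth n p" "orth n q" shows "orth n (p - q)"
proof -
  have "ip (\<lambda>z. z ^ j) (poly (p - q)) = ip (\<lambda>z. z ^ j) (poly p) - ip (\<lambda>z. z ^ j) (poly q)" for j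
    unfolding poly_diff right_diff_distrib
    by (rule Bochner_Integration.integral_diff) (rule integrable_monom_poly)+
  then show ?thesis using assms by (simp add: orth_def)
qed

section \<open>Existence, uniqueness and the Szego recursion\<close>

definition monic_orth :: "nat \<Rightarrow> complex poly \<Rightarrow> bool" where
  "monic_orth n p \<longleftrightarrow> degree p = n \<and> lead_coeff p = 1 \<and> orth n p"

lemma monic_orth_unique:
  assumes "monic_orth n p" "monic_orth n q" shows "p = q"
proof -
  have "coeff (p - q) i = 0" if "i \<ge> n" for i
    using assms that by (cases "i = n") (auto simp: monic_orth_def coeff_eq_0)
  then have "p - q = 0" using assms orth_zero orth_diff unfolding monic_orth_def by blast
  then show ?thesis by simp
qed

text \<open>On the circle the reversal is \<open>z ^ n * cnj (poly p z)\<close>. Thus orthogonality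
  of \<open>p\<close> to \<open>1, ..., z ^ (n - 1)\<close> becomes orthogonality of its reversal to
  \<open>z, ..., z ^ n\<close>.\<close>

lemma ip_rev_poly:
  assumes "degree p = n" "j \<le> n"
  shows "ip (\<lambda>z. z ^ j) (poly (rev_poly p)) = cnj (ip (\<lambda>z. z ^ (n - j)) (poly p))"
proof -
  have "cnj (z ^ j) * poly (rev_poly p) z = cnj (cnj (z ^ (n - j)) * poly p z)" if "norm z = 1" for z
  proof -
    have "cnj z * z = 1" using that by (rule cnj_mult_circle)
    then have "cnj z ^ j * z ^ j = 1" by (metis power_mult_distrib power_one)
    then have "cnj z ^ j * z ^ n = z ^ (n - j)"
      using assms(2) by (metis le_add_diff_inverse mult.assoc mult_1 power_add)
    then show ?thesis using assms(1) that by (simp add: poly_rev_poly_circle mult.assoc [symmetric])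
  qed
  then have "AE z in mu. cnj (z ^ j) * poly (rev_poly p) z = cnj (cnj (z ^ (n - j)) * poly p z)"
    using AE_circle by (auto elim: eventually_mono)
  then have "ip (\<lambda>z. z ^ j) (poly (rev_poly p)) = (\<integral>z. cnj (cnj (z ^ (n - j)) * poly p z) \<partial>mu)"
    by (intro integral_cong_AE)
       (auto intro!: borel_measurable_integrable integrable_continuous continuous_intros)
  also have "\<dots> = cnj (ip (\<lambda>z. z ^ (n - j)) (poly p))" by (rule Bochner_Integration.integral_cnj)
  finally show ?thesis .
qed

text \<open>Multiplication by \<open>z\<close> preserves inner products, since
  \<open>norm z = 1\<close> almost everywhere.\<close>

lemma ip_shift:
  "ip (\<lambda>z. z ^ Suc j) (poly (pCons 0 p)) = ip (\<lambda>z. z ^ j) (poly p)"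
proof (rule integral_cong_AE)
  show "AE z in mu. cnj (z ^ Suc j) * poly (pCons 0 p) z = cnj (z ^ j) * poly p z"
    using AE_circle
  proof eventually_elim
    case (elim z)
    then have "cnj z * z = 1" by (rule cnj_mult_circle)
    then show ?case by (simp add: algebra_simps)
  qed
qed (auto intro!: borel_measurable_integrable integrable_continuous continuous_intros)

text \<open>Both \<open>z * p\<close> and the reversal of \<open>p\<close> are orthogonal to
  \<open>z, ..., z ^ n\<close>, so one constant suffices to remove the inner product with
  \<open>1\<close>. This gives existence by induction and, with uniqueness, the recursion.\<close>

lemma monic_orth_Suc:
  assumes p: "monic_orth n p"
  shows "\<exists>c. monic_orth (Suc n) (pCons 0 p - smult c (rev_poly p))"
proof -
  have deg: "degree p = n" and lc: "lead_coeff p = 1" and op: "orth n p"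
    using p by (auto simp: monic_orth_def)
  have p0: "p \<noteq> 0" using lc by auto
  \<comment> \<open>\<open>q\<close> has lower order, so the inner product of \<open>z ^ n\<close>
    with \<open>p\<close> is the squared norm of \<open>p\<close>; hence the denominator of
    \<open>c\<close> is nonzero.\<close>
  define q where "q = p - monom 1 n"
  have qc: "coeff q i = 0" if "i \<ge> n" for i
    using deg lc that by (cases "i = n") (auto simp: q_def coeff_eq_0)
  have "ip (poly p) (poly p) = ip (\<lambda>z. z ^ n) (poly p) + ip (poly q) (poly p)"
    by (subst Bochner_Integration.integral_add [symmetric])
       (auto simp: q_def poly_monom algebra_simps simp del: complex_cnj_power
             intro!: integrable_continuous continuous_intros)
  then have "ip (\<lambda>z. z ^ n) (poly p) = ip (poly p) (poly p)" using ip_orth[OF op qc] by simp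
  then have ne: "ip (\<lambda>z. z ^ 0) (poly (rev_poly p)) \<noteq> 0"
    using ip_rev_poly[OF deg, of 0] ip_self_eq[of p] ip_self_pos[OF p0] by auto
  define c where "c = ip (\<lambda>z. z ^ 0) (poly (pCons 0 p)) / ip (\<lambda>z. z ^ 0) (poly (rev_poly p))"
  let ?P = "pCons 0 p - smult c (rev_poly p)"
  have ipP: "ip (\<lambda>z. z ^ j) (poly ?P) = ip (\<lambda>z. z ^ j) (poly (pCons 0 p)) - c * ip (\<lambda>z. z ^ j) (poly (rev_poly p))" for j
  proof -
    have "ip (\<lambda>z. z ^ j) (poly ?P) = (\<integral>z. cnj (z ^ j) * poly (pCons 0 p) z - c * (cnj (z ^ j) * poly (rev_poly p) z) \<partial>mu)"
      by (intro Bochner_Integration.integral_cong refl) (simp add: algebra_simps)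
    also have "\<dots> = ip (\<lambda>z. z ^ j) (poly (pCons 0 p)) - (\<integral>z. c * (cnj (z ^ j) * poly (rev_poly p) z) \<partial>mu)"
      by (intro Bochner_Integration.integral_diff integrable_mult_right integrable_monom_poly)
    finally show ?thesis by simp
  qed
  have "ip (\<lambda>z. z ^ j) (poly ?P) = 0" if "j < Suc n" for j
  proof (cases j)
    case 0
    then show ?thesis using ipP[of 0] ne by (simp add: c_def)
  next
    case (Suc i)
    then have "ip (\<lambda>z. z ^ j) (poly (pCons 0 p)) = 0"
      using op that ip_shift unfolding orth_def by (metis Suc_less_SucD)
    moreover have "ip (\<lambda>z. z ^ j) (poly (rev_poly p)) = 0"
      using op that Suc ip_rev_poly[OF deg, of j] unfolding orth_def by auto
    ultimately show ?thesis using ipP[of j] by simp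
  qed
  moreover have dl: "degree (smult c (rev_poly p)) \<le> n"
    using degree_rev_poly_le[of p] deg by (metis degree_smult_le le_trans)
  then have "degree ?P = Suc n"
    using deg p0 degree_add_eq_left[of "- smult c (rev_poly p)" "pCons 0 p"]
    by (simp add: degree_pCons_eq del: degree_smult_eq)
  moreover have "coeff ?P (Suc n) = 1"
    using dl deg lc by (simp add: coeff_eq_0 le_imp_less_Suc del: coeff_smult)
  ultimately show ?thesis by (auto simp: monic_orth_def orth_def)
qed

lemma monic_orth_exists: "\<exists>p. monic_orth n p"
proof (induction n)
  case 0
  have "monic_orth 0 1" by (simp add: monic_orth_def orth_def)
  then show ?case ..
next
  case (Suc n)
  then show ?case using monic_orth_Suc by blast
qed

abbreviation "\<Phi> \<equiv> OPUC mu"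
abbreviation "\<alpha> \<equiv> verblunsky mu"
abbreviation "\<Phi>s n \<equiv> rev_poly (OPUC mu n)"

lemma monic_orth_OPUC: "monic_orth n (\<Phi> n)"
proof -
  have "OPUC mu n = (THE p. monic_orth n p)"
    unfolding OPUC_def monic_orth_def orth_def by simp
  then show ?thesis using monic_orth_exists monic_orth_unique by (metis theI')
qed

lemma degree_OPUC [simp]: "degree (\<Phi> n) = n"
  and lead_coeff_OPUC: "lead_coeff (\<Phi> n) = 1"
  and orth_OPUC: "orth n (\<Phi> n)"
  using monic_orth_OPUC[of n] by (auto simp: monic_orth_def)

lemma OPUC_0: "\<Phi> 0 = 1"
  by (rule monic_orth_unique[OF monic_orth_OPUC]) (simp add: monic_orth_def orth_def)

text \<open>The constant of the construction is identified by evaluating at \<open>0\<close>, where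
  the reversal of a monic polynomial equals \<open>1\<close>.\<close>

lemma poly_OPUC_Suc:
  "poly (\<Phi> (Suc n)) z = z * poly (\<Phi> n) z - cnj (\<alpha> n) * poly (\<Phi>s n) z"
proof -
  obtain c where "monic_orth (Suc n) (pCons 0 (\<Phi> n) - smult c (\<Phi>s n))"
    using monic_orth_Suc[OF monic_orth_OPUC] by blast
  then have eq: "\<Phi> (Suc n) = pCons 0 (\<Phi> n) - smult c (\<Phi>s n)"
    using monic_orth_unique[OF monic_orth_OPUC] by blast
  have "poly (\<Phi> (Suc n)) 0 = - c"
    unfolding eq by (simp add: poly_rev_poly_0 lead_coeff_OPUC [simplified])
  then have "c = cnj (\<alpha> n)" by (simp add: verblunsky_def)
  then show ?thesis by (simp add: eq)
qed

text \<open>This is the reversal of the recursion for \<open>\<Phi>\<close>. The origin is treated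
  apart because the reversal formula evaluates at \<open>1 / cnj z\<close>.\<close>

lemma poly_rev_OPUC_Suc:
  "poly (\<Phi>s (Suc n)) z = poly (\<Phi>s n) z - \<alpha> n * z * poly (\<Phi> n) z"
proof (cases "z = 0")
  case True
  then show ?thesis by (simp add: poly_rev_poly_0 lead_coeff_OPUC [simplified])
next
  case False
  have *: "cnj (poly (\<Phi>s n) (1 / cnj z)) = poly (\<Phi> n) z / z ^ n"
    using False poly_rev_poly[of "1 / cnj z" "\<Phi> n"] by (simp add: power_divide)
  show ?thesis
    using False by (simp add: poly_rev_poly poly_OPUC_Suc * field_simps)
qed

text \<open>If \<open>\<Phi>\<^sub>n = (z - w) q\<close>, then \<open>z q = \<Phi>\<^sub>n + w q\<close> is an orthogonal decomposition, and
  \<open>z q\<close> has the same norm as \<open>q\<close>.\<close>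

lemma OPUC_zero_in_disk:
  assumes "poly (\<Phi> n) w = 0"
  shows "norm w < 1"
proof -
  obtain q where q: "\<Phi> n = [:-w, 1:] * q" using assms by (metis dvdE poly_eq_0_iff_dvd)
  have p0: "\<Phi> n \<noteq> 0" using lead_coeff_OPUC[of n] by auto
  then have q0: "q \<noteq> 0" using q by auto
  have "degree (\<Phi> n) = Suc (degree q)" using q q0 degree_mult_eq[of "[:-w, 1:]" q] by simp
  then have dq: "coeff q i = 0" if "i \<ge> n" for i using that by (simp add: coeff_eq_0)
  define N where "N p = (\<integral>z. (cmod (poly p z))\<^sup>2 \<partial>mu)" for p :: "complex poly"
  have cross: "ip (poly q) (poly (\<Phi> n)) = 0" using ip_orth[OF orth_OPUC dq] .
  \<comment> \<open>\<open>2 * g\<close> is the cross term in the expansion of the squared modulus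
    of \<open>\<Phi>\<^sub>n + w q\<close>; it integrates to zero by \<open>cross\<close>.\<close>
  define g where "g z = Re (cnj w * (cnj (poly q z) * poly (\<Phi> n) z))" for z
  have gi: "integrable mu g"
    unfolding g_def by (intro integrable_Re integrable_mult_right integrable_poly_prod)
  have "integral\<^sup>L mu g = Re (cnj w * ip (poly q) (poly (\<Phi> n)))"
    unfolding g_def by (subst integral_Re) (intro integrable_mult_right integrable_poly_prod, simp)
  then have g0: "integral\<^sup>L mu g = 0" using cross by simp
  have "AE z in mu. (cmod (poly q z))\<^sup>2 =
      (cmod (poly (\<Phi> n) z))\<^sup>2 + (cmod w)\<^sup>2 * (cmod (poly q z))\<^sup>2 + 2 * g z"
    using AE_circle
  proof eventually_elim
    case (elim z)
    have "poly (\<Phi> n) z + w * poly q z = z * poly q z" by (simp add: q algebra_simps)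
    then have "(cmod (poly q z))\<^sup>2 = (cmod (poly (\<Phi> n) z + w * poly q z))\<^sup>2"
      using elim by (simp add: norm_mult)
    also have "\<dots> = (cmod (poly (\<Phi> n) z))\<^sup>2 + (cmod w)\<^sup>2 * (cmod (poly q z))\<^sup>2 + 2 * g z"
      unfolding cmod_power2 g_def by (simp add: power2_eq_square algebra_simps)
    finally show ?case .
  qed
  then have "N q = (\<integral>z. (cmod (poly (\<Phi> n) z))\<^sup>2 + (cmod w)\<^sup>2 * (cmod (poly q z))\<^sup>2 + 2 * g z \<partial>mu)"
    unfolding N_def
    by (intro integral_cong_AE)
       (auto intro!: borel_measurable_integrable Bochner_Integration.integrable_add
          norm_sq_integrable integrable_mult_right gi)
  also have "\<dots> = N (\<Phi> n) + (cmod w)\<^sup>2 * N q"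
    unfolding N_def using g0
    by (simp add: Bochner_Integration.integral_add Bochner_Integration.integrable_add norm_sq_integrable gi)
  finally have "N q * (1 - (cmod w)\<^sup>2) = N (\<Phi> n)" by (simp add: algebra_simps)
  moreover have "N (\<Phi> n) > 0" "N q > 0" using ip_self_pos p0 q0 by (auto simp: N_def)
  ultimately have "1 - (cmod w)\<^sup>2 > 0" by (metis zero_less_mult_pos)
  then show ?thesis by (simp add: abs_square_less_1)
qed

section \<open>Zeros and growth of the orthogonal polynomials\<close>

definition zeros :: "nat \<Rightarrow> nat \<Rightarrow> complex" where
  "zeros n = (SOME z. \<Phi> n = (\<Prod>i<n. [:- z i, 1:]) \<and> zero_mset (\<Phi> n) = image_mset z (mset_set {..<n}))"

lemma zeros: "\<Phi> n = (\<Prod>i<n. [:- zeros n i, 1:])"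
  "zero_mset (\<Phi> n) = image_mset (zeros n) (mset_set {..<n})"
proof -
  have "\<exists>z. \<Phi> n = (\<Prod>i<n. [:- z i, 1:]) \<and> zero_mset (\<Phi> n) = image_mset z (mset_set {..<n})"
    by (rule monic_poly_zeros[OF degree_OPUC lead_coeff_OPUC]) blast
  from someI_ex[OF this] show "\<Phi> n = (\<Prod>i<n. [:- zeros n i, 1:])"
    "zero_mset (\<Phi> n) = image_mset (zeros n) (mset_set {..<n})"
    by (auto simp: zeros_def)
qed

lemma poly_OPUC_prod: "poly (\<Phi> n) w = (\<Prod>i<n. w - zeros n i)"
  by (subst zeros(1)) (simp add: poly_prod)

lemma norm_zeros: "i < n \<Longrightarrow> norm (zeros n i) < 1"
  by (rule OPUC_zero_in_disk[of n]) (auto simp: poly_OPUC_prod)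

lemma poly_rev_OPUC_prod: "poly (\<Phi>s n) w = (\<Prod>i<n. 1 - cnj (zeros n i) * w)"
proof (cases "w = 0")
  case True
  then show ?thesis by (simp add: poly_rev_poly_0 lead_coeff_OPUC [simplified])
next
  case False
  then have "poly (\<Phi>s n) w = (\<Prod>i<n. w * cnj (1 / cnj w - zeros n i))"
    by (simp add: poly_rev_poly poly_OPUC_prod prod.distrib)
  also have "\<dots> = (\<Prod>i<n. 1 - cnj (zeros n i) * w)"
    using False by (intro prod.cong refl) (simp add: algebra_simps)
  finally show ?thesis .
qed

text \<open>The comparison holds for each zero separately. It bounds the quotient
  \<open>\<Phi>\<^sub>n / \<Phi>\<^sub>n\<^sup>*\<close> by \<open>1\<close> on the disk.\<close>

lemma norm_OPUC_le_rev:
  assumes "norm w \<le> 1"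
  shows "norm (poly (\<Phi> n) w) \<le> norm (poly (\<Phi>s n) w)"
  unfolding poly_OPUC_prod poly_rev_OPUC_prod prod_norm [symmetric]
  using assms norm_zeros by (intro prod_mono) (auto intro!: norm_diff_le_norm_rev simp: less_imp_le)

text \<open>\<open>\<alpha> n\<close> is read off from the value of \<open>\<Phi> (Suc n)\<close> at
  \<open>0\<close>, hence the shifted index. This turns the root hypothesis into information on the
  geometric mean of the moduli.\<close>

lemma norm_verblunsky: "norm (\<alpha> n) = (\<Prod>i<Suc n. norm (zeros (Suc n) i))"
  unfolding verblunsky_def by (simp add: poly_OPUC_prod prod_norm [symmetric] norm_mult del: prod.lessThan_Suc)

lemma norm_verblunsky_le_1: "norm (\<alpha> n) \<le> 1"
  unfolding norm_verblunsky using norm_zeros by (intro prod_le_1) (auto simp: less_imp_le)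

definition abs_sum :: "nat \<Rightarrow> real" where "abs_sum n = (\<Sum>j<n. norm (\<alpha> j))"

text \<open>Since \<open>\<Phi>\<^sub>n\<close> is dominated by its reversal, each step costs a
  factor of at most \<open>1 + norm (\<alpha> n) \<le> exp (norm (\<alpha> n))\<close>.\<close>

lemma norm_rev_OPUC_le:
  assumes "norm w \<le> 1"
  shows "norm (poly (\<Phi>s n) w) \<le> exp (abs_sum n)"
proof (induction n)
  case 0
  then show ?case by (simp add: poly_rev_OPUC_prod abs_sum_def)
next
  case (Suc n)
  have "norm (\<alpha> n * w * poly (\<Phi> n) w) \<le> norm (\<alpha> n) * 1 * norm (poly (\<Phi>s n) w)"
    unfolding norm_mult using assms norm_OPUC_le_rev[OF assms] by (intro mult_mono) auto
  then have "norm (poly (\<Phi>s (Suc n)) w) \<le> (1 + norm (\<alpha> n)) * norm (poly (\<Phi>s n) w)"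
    unfolding poly_rev_OPUC_Suc
    using norm_triangle_ineq4[of "poly (\<Phi>s n) w" "\<alpha> n * w * poly (\<Phi> n) w"] by (simp add: algebra_simps)
  also have "\<dots> \<le> exp (norm (\<alpha> n)) * exp (abs_sum n)"
    using Suc by (intro mult_mono) auto
  finally show ?case by (simp add: abs_sum_def exp_add mult.commute)
qed

text \<open>In each step of the recursion the first term multiplies the bound by at most
  \<open>R\<close> and the second adds at most \<open>C * R ^ Suc n\<close>; the additions
  accumulate to the linear factor.\<close>

lemma norm_OPUC_bound:
  assumes "0 < R" "\<rho> \<le> R" "\<rho> \<le> 1" "C \<ge> 1"
    and C: "\<And>n. norm (\<alpha> n) * exp (abs_sum n) \<le> C * R ^ Suc n"
    and w: "norm w \<le> \<rho>"
  shows "norm (poly (\<Phi> n) w) \<le> C * (real n + 1) * R ^ n"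
proof (induction n)
  case 0
  then show ?case using assms by (simp add: OPUC_0)
next
  case (Suc n)
  have "norm (poly (\<Phi> (Suc n)) w) \<le> norm w * norm (poly (\<Phi> n) w) + norm (\<alpha> n) * norm (poly (\<Phi>s n) w)"
    unfolding poly_OPUC_Suc by (metis complex_mod_cnj norm_mult norm_triangle_ineq4)
  also have "\<dots> \<le> R * (C * (real n + 1) * R ^ n) + norm (\<alpha> n) * exp (abs_sum n)"
    using assms Suc norm_rev_OPUC_le[of w n] by (intro add_mono mult_mono) auto
  also have "\<dots> \<le> R * (C * (real n + 1) * R ^ n) + C * R ^ Suc n" using C by simp
  finally show ?case by (simp add: algebra_simps)
qed

text \<open>For \<open>norm w < 1/2\<close> the reversed polynomial is a product of factors
  \<open>1 + u j w\<close> with \<open>norm (u j w) \<le> norm (\<alpha> j)\<close>. Their principal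
  logarithms sum to a logarithm of modulus at most \<open>2 * abs_sum n\<close>, and
  \<open>power_sum_bound_of_log\<close> applies to the conjugated zeros.\<close>

lemma power_sum_zeros_bound:
  "norm (\<Sum>i<n. zeros n i ^ Suc k) \<le> fact (Suc k) * 4 ^ Suc k * (2 * abs_sum n)"
proof -
  \<comment> \<open>By the recursion, \<open>1 + u j\<close> is the quotient of consecutive reversed polynomials.\<close>
  define u where "u j w = - \<alpha> j * w * poly (\<Phi> j) w / poly (\<Phi>s j) w" for j w
  define L where "L w = (\<Sum>j<n. Ln (1 + u j w))" for w
  have nz: "poly (\<Phi>s j) w \<noteq> 0" if "norm w < 1" for j w
  proof -
    have "norm (cnj (zeros j i) * w) < 1" if "i < j" for i
      using norm_zeros[OF that] \<open>norm w < 1\<close> mult_left_le_one_le[of "norm w" "norm (zeros j i)"]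
      by (simp add: norm_mult)
    then show ?thesis by (fastforce simp: poly_rev_OPUC_prod)
  qed
  have u: "norm (u j w) < 1/2" "norm (u j w) \<le> norm (\<alpha> j)" if w: "norm w < 1/2" for j w
  proof -
    have "norm (poly (\<Phi> j) w / poly (\<Phi>s j) w) \<le> 1"
      using norm_OPUC_le_rev[of w j] nz[of w j] w by (simp add: norm_divide)
    then have *: "norm (u j w) \<le> norm (\<alpha> j) * norm w"
      using mult_left_mono[of "norm (poly (\<Phi> j) w / poly (\<Phi>s j) w)" 1 "norm (\<alpha> j) * norm w"]
      by (simp add: u_def norm_mult norm_divide)
    moreover have "norm (\<alpha> j) * norm w \<le> norm w" "norm (\<alpha> j) * norm w \<le> norm (\<alpha> j)"
      using norm_verblunsky_le_1[of j] w by (auto intro: mult_left_le_one_le mult_left_le)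
    ultimately show "norm (u j w) < 1/2" "norm (u j w) \<le> norm (\<alpha> j)" using w by linarith+
  qed
  have ne: "1 + u j w \<noteq> 0" "1 + u j w \<notin> \<real>\<^sub>\<le>\<^sub>0" if w: "norm w < 1/2" for j w
  proof -
    have "Re (1 + u j w) > 0" using u(1)[OF w, of j] abs_Re_le_cmod[of "u j w"] by simp
    then show "1 + u j w \<notin> \<real>\<^sub>\<le>\<^sub>0" by (auto simp: complex_nonpos_Reals_iff)
    then show "1 + u j w \<noteq> 0" by force
  qed
  have "norm (\<Sum>i<n. cnj (zeros n i) ^ Suc k) \<le> fact (Suc k) * 4 ^ Suc k * (2 * abs_sum n)"
  proof (rule power_sum_bound_of_log)
    have "u j holomorphic_on ball 0 (1/2)" for j
      unfolding u_def using nz by (intro holomorphic_intros) (auto simp: poly_pcompose)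
    then show "L holomorphic_on ball 0 (1/2)"
      unfolding L_def using ne by (auto intro!: holomorphic_intros)
    show "norm (L w) \<le> 2 * abs_sum n" if w: "norm w < 1/2" for w
    proof -
      have "norm (L w) \<le> (\<Sum>j<n. norm (Ln (1 + u j w)))" unfolding L_def by (rule norm_sum)
      also have "\<dots> \<le> (\<Sum>j<n. 2 * norm (\<alpha> j))"
      proof (rule sum_mono)
        fix j
        show "norm (Ln (1 + u j w)) \<le> 2 * norm (\<alpha> j)"
          using norm_Ln_le[OF u(1)[OF w, of j]] u(2)[OF w, of j] by linarith
      qed
      finally show ?thesis by (simp add: abs_sum_def sum_distrib_left)
    qed
    show "exp (L w) = (\<Prod>i<n. 1 - cnj (zeros n i) * w)" if w: "norm w < 1/2" for w
    proof -
      \<comment> \<open>The product of the quotients telescopes from \<open>\<Phi>s 0\<close>, which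
        is \<open>1\<close>.\<close>
      have "exp (\<Sum>j<m. Ln (1 + u j w)) = poly (\<Phi>s m) w" for m
      proof (induction m)
        case 0
        then show ?case by (simp add: poly_rev_OPUC_prod)
      next
        case (Suc m)
        then show ?case using ne(1)[OF w, of m] nz[of w m] w
          by (simp add: exp_add poly_rev_OPUC_Suc u_def field_simps)
      qed
      then show ?thesis by (simp add: L_def poly_rev_OPUC_prod)
    qed
    show "norm (cnj (zeros n i)) \<le> 1" if "i < n" for i using norm_zeros[OF that] by simp
  qed
  moreover have "(\<Sum>i<n. cnj (zeros n i) ^ Suc k) = cnj (\<Sum>i<n. zeros n i ^ Suc k)"
    by simp
  ultimately show ?thesis by (metis complex_mod_cnj)
qed

lemma integral_zero_counting_measure:
  fixes f :: "complex \<Rightarrow> real"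
  assumes "n > 0"
  shows "(\<integral>x. f x \<partial>zero_counting_measure mu n) = (\<Sum>i<n. f (zeros n i)) / n"
  unfolding zero_counting_measure_def zeros(2) by (rule integral_pmf_of_multiset_image[OF assms])

section \<open>Asymptotics of the zeros\<close>

context
  fixes r :: real
  assumes root_lim: "(\<lambda>n. root n (norm (\<alpha> n))) \<longlonglongrightarrow> r"
    and cesaro: "(\<lambda>n. abs_sum n / real n) \<longlonglongrightarrow> 0"
begin

lemma rate_range: "0 \<le> r" "r \<le> 1"
proof -
  show "0 \<le> r" by (rule LIMSEQ_le_const[OF root_lim]) (auto intro!: real_root_ge_zero)
  have "root n (norm (\<alpha> n)) \<le> 1" for n
    using norm_verblunsky_le_1[of n] by (cases "n = 0") auto
  then show "r \<le> 1" by (intro LIMSEQ_le_const2[OF root_lim]) auto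
qed

text \<open>The Cesaro hypothesis makes \<open>exp (abs_sum n)\<close> subexponential, so the
  \<open>n\<close>-th root of the left-hand side still tends to \<open>r < R\<close>.\<close>

lemma verblunsky_exp_bound:
  assumes "r < R"
  obtains C where "C \<ge> 1" "\<And>n. norm (\<alpha> n) * exp (abs_sum n) \<le> C * R ^ Suc n"
proof -
  have R: "R > 0" using assms rate_range by linarith
  have "(\<lambda>n. root n (norm (\<alpha> n)) * exp (abs_sum n / real n)) \<longlonglongrightarrow> r * exp 0"
    by (intro tendsto_intros root_lim cesaro)
  then have "eventually (\<lambda>n. root n (norm (\<alpha> n)) * exp (abs_sum n / real n) < R) sequentially"
    using assms by (intro order_tendstoD) auto
  then obtain N where N: "\<And>n. n \<ge> N \<Longrightarrow> root n (norm (\<alpha> n)) * exp (abs_sum n / real n) < R"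
    by (auto simp: eventually_sequentially)
  define T where "T = (\<Sum>n\<le>N. norm (\<alpha> n) * exp (abs_sum n) / R ^ Suc n)"
  have T0: "T \<ge> 0" unfolding T_def using R by (intro sum_nonneg) auto
  show thesis
  \<comment> \<open>\<open>1\<close> secures the lower bound on the constant, \<open>1 / R\<close>
    pays for \<open>R ^ n\<close> against \<open>R ^ Suc n\<close>, and \<open>T\<close> covers the
    indices up to \<open>N\<close>.\<close>
  proof (rule that[of "1 + 1 / R + T"])
    show "1 + 1 / R + T \<ge> 1" using R T0 by simp
    fix n
    have "norm (\<alpha> n) * exp (abs_sum n) / R ^ Suc n \<le> 1 + 1 / R + T"
    proof (cases "n \<le> N")
      case True
      then have "norm (\<alpha> n) * exp (abs_sum n) / R ^ Suc n \<le> T"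
        unfolding T_def using R by (intro member_le_sum) auto
      then show ?thesis using R by (simp add: add_increasing)
    next
      case False
      then have n: "n > 0" by simp
      have "norm (\<alpha> n) * exp (abs_sum n) = (root n (norm (\<alpha> n)) * exp (abs_sum n / real n)) ^ n"
        using n by (simp add: power_mult_distrib exp_of_nat_mult [symmetric])
      also have "\<dots> \<le> R ^ n"
        using N[of n] False by (intro power_mono) (auto intro!: mult_nonneg_nonneg real_root_ge_zero)
      finally have "norm (\<alpha> n) * exp (abs_sum n) / R ^ Suc n \<le> 1 / R"
        using R by (simp add: divide_simps)
      then show ?thesis using T0 by simp
    qed
    then show "norm (\<alpha> n) * exp (abs_sum n) \<le> (1 + 1 / R + T) * R ^ Suc n"
      using R by (subst (asm) pos_divide_le_eq) auto
  qed
qed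

text \<open>The growth bound on the circle of radius \<open>\<rho>\<close> limits, through
  \<open>prod_max_le_sup_circle\<close>, how far zeros lie outside it. A radius separate from
  \<open>r\<close> is kept so that \<open>r = 0\<close> can be approached by small positive
  \<open>\<rho>\<close>.\<close>

lemma mean_ln_max_zeros:
  assumes \<rho>: "0 < \<rho>" "\<rho> \<le> 1" "r \<le> \<rho>" and e: "e > 0"
  shows "eventually (\<lambda>n. (\<Sum>i<n. ln (max (norm (zeros n i)) \<rho> / \<rho>)) / n < e) sequentially"
proof -
  \<comment> \<open>\<open>ln R\<close> exceeds \<open>ln \<rho>\<close> by exactly
    \<open>e / 2\<close>; the other half absorbs the terms
    \<open>(ln C + ln (n + 1)) / n\<close>.\<close>
  define R where "R = \<rho> * exp (e / 2)"
  have "exp (e / 2) > 1" using e by simp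
  then have R\<rho>: "\<rho> < R" using \<rho>(1) by (simp add: R_def)
  then have R: "r < R" "0 < R" using \<rho> by linarith+
  obtain C where C: "C \<ge> 1" "\<And>n. norm (\<alpha> n) * exp (abs_sum n) \<le> C * R ^ Suc n"
    using verblunsky_exp_bound[OF R(1)] by blast
  have bound: "(\<Sum>i<n. ln (max (norm (zeros n i)) \<rho> / \<rho>)) \<le> ln C + ln (real n + 1) + n * (e / 2)" for n
  proof -
    have "(\<Prod>i<n. max (norm (zeros n i)) \<rho>) \<le> C * (real n + 1) * R ^ n"
      using norm_OPUC_bound[OF R(2) less_imp_le[OF R\<rho>] \<rho>(2) C]
      by (intro prod_max_le_sup_circle[OF \<rho>(1)]) (simp add: poly_OPUC_prod [symmetric])
    moreover have "(\<Prod>i<n. max (norm (zeros n i)) \<rho>) > 0" using \<rho>(1) by (intro prod_pos) auto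
    ultimately have "ln (\<Prod>i<n. max (norm (zeros n i)) \<rho>) \<le> ln (C * (real n + 1) * R ^ n)"
      by (intro ln_mono) auto
    also have "ln (\<Prod>i<n. max (norm (zeros n i)) \<rho>) = (\<Sum>i<n. ln (max (norm (zeros n i)) \<rho>))"
      using \<rho>(1) by (intro ln_prod) (auto simp: max_def)
    also have "ln (C * (real n + 1) * R ^ n) = ln C + ln (real n + 1) + n * ln R"
      using C(1) R(2) by (simp add: ln_mult ln_realpow)
    also have "ln R = ln \<rho> + e / 2" using \<rho>(1) by (simp add: R_def ln_mult)
    finally have "(\<Sum>i<n. ln (max (norm (zeros n i)) \<rho>)) \<le> ln C + ln (real n + 1) + n * (ln \<rho> + e / 2)" .
    moreover have "(\<Sum>i<n. ln (max (norm (zeros n i)) \<rho> / \<rho>)) = (\<Sum>i<n. ln (max (norm (zeros n i)) \<rho>)) - n * ln \<rho>"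
    proof -
      have "(\<Sum>i<n. ln (max (norm (zeros n i)) \<rho> / \<rho>)) = (\<Sum>i<n. ln (max (norm (zeros n i)) \<rho>) - ln \<rho>)"
        using \<rho>(1) by (intro sum.cong refl) (auto simp: ln_div max_def)
      then show ?thesis by (simp add: sum_subtractf)
    qed
    ultimately show ?thesis by (simp add: algebra_simps)
  qed
  have "(\<lambda>n. (ln C + ln (real n + 1)) / real n) \<longlonglongrightarrow> 0" by real_asymp
  then have "eventually (\<lambda>n. (ln C + ln (real n + 1)) / real n < e / 2) sequentially"
    using e by (intro order_tendstoD) auto
  then show ?thesis using eventually_gt_at_top[of 0]
  proof eventually_elim
    case (elim n)
    have "(\<Sum>i<n. ln (max (norm (zeros n i)) \<rho> / \<rho>)) / n \<le> (ln C + ln (real n + 1) + n * (e / 2)) / n"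
      using bound[of n] elim(2) by (intro divide_right_mono) auto
    also have "\<dots> = (ln C + ln (real n + 1)) / n + e / 2" using elim(2) by (simp add: field_simps)
    also have "\<dots> < e" using elim(1) by linarith
    finally show ?case .
  qed
qed

text \<open>The product of the moduli is \<open>norm (\<alpha> n)\<close>. As \<open>r > 0\<close>,
  it is eventually nonzero, so its logarithm splits into a sum over the zeros.\<close>

lemma mean_ln_zeros:
  assumes "r > 0"
  shows "(\<lambda>n. (\<Sum>i<Suc n. ln (norm (zeros (Suc n) i) / r)) / Suc n) \<longlonglongrightarrow> 0"
    and "eventually (\<lambda>n. \<forall>i<Suc n. zeros (Suc n) i \<noteq> 0) sequentially"
proof -
  have "eventually (\<lambda>n. root n (norm (\<alpha> n)) > 0) sequentially"
    using root_lim assms by (rule order_tendstoD)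
  then have "eventually (\<lambda>n. norm (\<alpha> n) > 0) sequentially"
    using eventually_gt_at_top[of 0] by eventually_elim simp
  then show nz: "eventually (\<lambda>n. \<forall>i<Suc n. zeros (Suc n) i \<noteq> 0) sequentially"
  proof eventually_elim
    case (elim n)
    show ?case
    proof (intro allI impI notI)
      fix i assume "i < Suc n" "zeros (Suc n) i = 0"
      then have "(\<Prod>i<Suc n. norm (zeros (Suc n) i)) = 0" by (intro prod_zero) auto
      then show False using elim by (simp only: norm_verblunsky less_irrefl)
    qed
  qed
  \<comment> \<open>The root has order \<open>n\<close> but \<open>\<Phi> (Suc n)\<close> has
    \<open>Suc n\<close> zeros; the factor \<open>n / Suc n\<close> corrects this and tends to
    \<open>1\<close>.\<close>
  have "(\<lambda>n. ln (root n (norm (\<alpha> n))) * (real n / real (Suc n)) - ln r) \<longlonglongrightarrow> ln r * 1 - ln r"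
    using assms by (intro tendsto_intros root_lim LIMSEQ_n_over_Suc_n) auto
  moreover have "eventually (\<lambda>n. ln (root n (norm (\<alpha> n))) * (real n / real (Suc n)) - ln r
      = (\<Sum>i<Suc n. ln (norm (zeros (Suc n) i) / r)) / Suc n) sequentially"
    using nz eventually_gt_at_top[of 0]
  proof eventually_elim
    case (elim n)
    have "ln (norm (\<alpha> n)) = (\<Sum>i<Suc n. ln (norm (zeros (Suc n) i)))"
      unfolding norm_verblunsky using elim by (intro ln_prod) auto
    moreover have "(\<Sum>i<Suc n. ln (norm (zeros (Suc n) i) / r)) = (\<Sum>i<Suc n. ln (norm (zeros (Suc n) i)) - ln r)"
      using elim(1) assms by (intro sum.cong refl) (auto simp: ln_div)
    ultimately have "(\<Sum>i<Suc n. ln (norm (zeros (Suc n) i) / r)) = ln (norm (\<alpha> n)) - real (Suc n) * ln r"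
      by (simp only: sum_subtractf) simp
    moreover have "ln (root n (norm (\<alpha> n))) = ln (norm (\<alpha> n)) / n"
      using elim by (simp add: ln_root norm_verblunsky prod_pos del: prod.lessThan_Suc)
    ultimately show ?case using elim(2) by (simp add: divide_simps)
  qed
  ultimately show "(\<lambda>n. (\<Sum>i<Suc n. ln (norm (zeros (Suc n) i) / r)) / Suc n) \<longlonglongrightarrow> 0"
    by (simp add: tendsto_cong)
qed


lemma mean_abs_radius_zeros: "(\<lambda>n. (\<Sum>i<n. \<bar>norm (zeros n i) - r\<bar>) / n) \<longlonglongrightarrow> 0"
proof -
  have "eventually (\<lambda>n. (\<Sum>i<n. \<bar>norm (zeros n i) - r\<bar>) / n < e) sequentially" if e: "e > 0" for e
  proof (cases "r = 0")
    case True
    \<comment> \<open>For \<open>r = 0\<close> an upper bound on the moduli suffices: each is at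
      most \<open>\<rho> \<le> e / 2\<close> plus a logarithmic excess whose mean is eventually
      below \<open>e / 2\<close>.\<close>
    define \<rho> where "\<rho> = min 1 (e / 2)"
    have \<rho>: "0 < \<rho>" "\<rho> \<le> 1" "r \<le> \<rho>" "\<rho> \<le> e / 2" using e True by (auto simp: \<rho>_def)
    have pt: "x \<le> \<rho> + ln (max x \<rho> / \<rho>)" if "x \<le> 1" for x
      using abs_diff_le_ln[of x \<rho>] that \<rho> by (cases "x \<le> \<rho>") (auto simp: max_def)
    show ?thesis
      using mean_ln_max_zeros[OF \<rho>(1-3) half_gt_zero[OF e]] eventually_gt_at_top[of 0]
    proof eventually_elim
      case (elim n)
      have "(\<Sum>i<n. \<bar>norm (zeros n i) - r\<bar>) \<le> (\<Sum>i<n. \<rho> + ln (max (norm (zeros n i)) \<rho> / \<rho>))"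
        using True norm_zeros by (intro sum_mono) (auto intro!: pt simp: less_imp_le)
      also have "\<dots> = n * \<rho> + (\<Sum>i<n. ln (max (norm (zeros n i)) \<rho> / \<rho>))" by (simp add: sum.distrib)
      also have "\<dots> < n * \<rho> + n * (e / 2)" using elim by (simp add: divide_simps mult.commute)
      also have "\<dots> \<le> n * (e / 2) + n * (e / 2)" using \<rho>(4) by (intro add_mono mult_left_mono) auto
      finally show ?case using elim by (simp add: divide_simps mult.commute)
    qed
  next
    case False
    then have r: "r > 0" "r \<le> 1" using rate_range by auto
    \<comment> \<open>The total \<open>e\<close> is split into \<open>e / 2\<close> for minus the
      mean logarithm and \<open>2 * (e / 4)\<close> for its positive part, which enters
      \<open>abs_diff_le_ln\<close> twice.\<close>
    have "eventually (\<lambda>n. - (e / 2) < (\<Sum>i<Suc n. ln (norm (zeros (Suc n) i) / r)) / Suc n) sequentially"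
      using e by (intro order_tendstoD(1)[OF mean_ln_zeros(1)[OF r(1)]]) auto
    moreover have "eventually (\<lambda>n. (\<Sum>i<Suc n. ln (max (norm (zeros (Suc n) i)) r / r)) / Suc n < e / 4) sequentially"
      using e by (intro eventually_sequentially_Suc [THEN iffD2, OF mean_ln_max_zeros] r order_refl) simp
    ultimately have "eventually (\<lambda>n. (\<Sum>i<Suc n. \<bar>norm (zeros (Suc n) i) - r\<bar>) / Suc n < e) sequentially"
      using mean_ln_zeros(2)[OF r(1)]
    proof eventually_elim
      case (elim n)
      have "(\<Sum>i<Suc n. \<bar>norm (zeros (Suc n) i) - r\<bar>)
          \<le> (\<Sum>i<Suc n. 2 * ln (max (norm (zeros (Suc n) i)) r / r) - ln (norm (zeros (Suc n) i) / r))"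
        using elim(3) norm_zeros r by (intro sum_mono abs_diff_le_ln) (auto intro: less_imp_le)
      also have "\<dots> = 2 * (\<Sum>i<Suc n. ln (max (norm (zeros (Suc n) i)) r / r)) - (\<Sum>i<Suc n. ln (norm (zeros (Suc n) i) / r))"
        by (simp only: sum_subtractf sum_distrib_left)
      finally have "(\<Sum>i<Suc n. \<bar>norm (zeros (Suc n) i) - r\<bar>) / Suc n
          \<le> (2 * (\<Sum>i<Suc n. ln (max (norm (zeros (Suc n) i)) r / r)) - (\<Sum>i<Suc n. ln (norm (zeros (Suc n) i) / r))) / Suc n"
        by (intro divide_right_mono) auto
      also have "\<dots> = 2 * ((\<Sum>i<Suc n. ln (max (norm (zeros (Suc n) i)) r / r)) / Suc n) - (\<Sum>i<Suc n. ln (norm (zeros (Suc n) i) / r)) / Suc n"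
        by (simp only: diff_divide_distrib times_divide_eq_right)
      finally show ?case using elim(1,2) by linarith
    qed
    then show ?thesis by (rule eventually_sequentially_Suc [THEN iffD1])
  qed
  moreover have "a < (\<Sum>i<n. \<bar>norm (zeros n i) - r\<bar>) / n" if "a < 0" for a :: real and n
    using that by (rule less_le_trans) (intro divide_nonneg_nonneg sum_nonneg; simp)
  ultimately show ?thesis by (auto intro!: order_tendstoI)
qed

lemma mean_power_zeros: "(\<lambda>n. (\<Sum>i<n. zeros n i ^ Suc k) / n) \<longlonglongrightarrow> 0"
proof (rule Lim_null_comparison)
  show "eventually (\<lambda>n. norm ((\<Sum>i<n. zeros n i ^ Suc k) / n) \<le> fact (Suc k) * 4 ^ Suc k * 2 * (abs_sum n / n)) sequentially"
    using eventually_gt_at_top[of 0]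
  proof eventually_elim
    case (elim n)
    then show ?case
      using divide_right_mono[OF power_sum_zeros_bound[of n k], of "real n"] by (simp add: norm_divide)
  qed
  show "(\<lambda>n. fact (Suc k) * 4 ^ Suc k * 2 * (abs_sum n / n)) \<longlonglongrightarrow> 0"
    by (rule tendsto_mult_right_zero[OF cesaro])
qed

end

end

theorem theorem6p2:
  fixes mu :: "complex measure" and r :: real
  assumes "prob_space mu"
    and "sets mu = sets borel"
    and "emeasure mu (- sphere 0 1) = 0"
    and "infinite (msupport mu)"
    and "(\<lambda>n. root n (cmod (verblunsky mu n))) \<longlonglongrightarrow> r"
    and "(\<lambda>n. (\<Sum>j<n. cmod (verblunsky mu j)) / real n) \<longlonglongrightarrow> 0"
  shows "weak_conv_c (zero_counting_measure mu) (circle_uniform r)"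
proof -
  interpret nontrivial_circle_measure mu
    using assms(1-4) by (simp add: nontrivial_circle_measure_def nontrivial_circle_measure_axioms_def)
  have cesaro: "(\<lambda>n. abs_sum n / real n) \<longlonglongrightarrow> 0" using assms(6) by (simp add: abs_sum_def)
  show ?thesis unfolding weak_conv_c_def
  proof (intro allI impI)
    fix f :: "complex \<Rightarrow> real"
    assume "continuous_on UNIV f \<and> bounded (range f)"
    then have "(\<lambda>n. (\<Sum>i<n. f (zeros n i)) / n) \<longlonglongrightarrow> integral\<^sup>L (circle_uniform r) f"
      using norm_zeros
      by (intro mean_tendsto_circle_uniform rate_range[OF assms(5) cesaro]
          mean_abs_radius_zeros[OF assms(5) cesaro] mean_power_zeros[OF assms(5) cesaro])
         (auto simp: less_imp_le)
    \<comment> \<open>The integral formula holds for \<open>n > 0\<close>, where the multiset of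
      zeros is nonempty; this is enough for the limit.\<close>
    moreover have "eventually (\<lambda>n. (\<Sum>i<n. f (zeros n i)) / n = (\<integral>x. f x \<partial>zero_counting_measure mu n)) sequentially"
      using eventually_gt_at_top[of 0] by eventually_elim (simp add: integral_zero_counting_measure)
    ultimately show "(\<lambda>n. \<integral>x. f x \<partial>zero_counting_measure mu n) \<longlonglongrightarrow> integral\<^sup>L (circle_uniform r) f"
      by (rule Lim_transform_eventually)
  qed
qed

end
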